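(* Let $H$ and $K$ be cancellative semigroups, at least one of which is commutative. Let $P$ be a downward complete subsemigroup of $\mathcal P(H)$, let $Q$ be a downward complete subsemigroup of $\mathcal P(K)$, and let $f \colon P \to Q$ be a semigroup isomorphism. Then $f$ restricts to an isomorphism from $H$ to $K$; that is, there is a semigroup isomorphism $\varphi \colon H \to K$ such that $f(\{x\}) = \{\varphi(x)\}$ for every $x \in H$.
   Context: All semigroups are written multiplicatively. For a semigroup $S$, $\mathcal P(S)$ (the large power semigroup of $S$) is the semigroup of all non-empty subsets of $S$ under setwise multiplication $XY := \{xy : x \in X,\ y \in Y\}$. A subsemigroup $P$ of $\mathcal P(S)$ is called downward complete if (i) each element of $S$ lies in at least one set $X \in P$, and (ii) every non-empty subset of a set in $P$ is itself in $P$. In particular, a downward complete subsemigroup of $\mathcal P(S)$ contains every one-element subset of $S$, and $S$ is identified with the subsemigroup of one-element subsets through the embedding $x \mapsto \{x\}$; the phrase "$f$ restricts to an isomorphism from $H$ to $K$" is understood up to this identification. A semigroup $S$ is cancellative if, for every $a \in S$, both maps $S \to S$, $x \mapsto ax$ and $x \mapsto xa$ are injective. *)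

theory Defs
  imports "HOL-Algebra.Coset"
begin

text \<open>
  Semigroups are represented by the \<open>carrier\<close> and \<open>mult\<close> fields of monoid records, so that
  \<^const>\<open>hom\<close>, \<^const>\<open>iso\<close> and \<^const>\<open>set_mult\<close>, none of which refers to the \<open>one\<close> field,
  can be used as they are. No assumption is ever made on \<open>one\<close>: it is a dummy.
\<close>

locale mult_semigroup =
  fixes S (structure)
  assumes m_closed: "\<lbrakk>x \<in> carrier S; y \<in> carrier S\<rbrakk> \<Longrightarrow> x \<otimes> y \<in> carrier S"
    and m_assoc: "\<lbrakk>x \<in> carrier S; y \<in> carrier S; z \<in> carrier S\<rbrakk>
                  \<Longrightarrow> (x \<otimes> y) \<otimes> z = x \<otimes> (y \<otimes> z)"

locale cancellative_semigroup = mult_semigroup +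
  assumes inj_left: "a \<in> carrier S \<Longrightarrow> inj_on (\<lambda>x. a \<otimes> x) (carrier S)"
    and inj_right: "a \<in> carrier S \<Longrightarrow> inj_on (\<lambda>x. x \<otimes> a) (carrier S)"

definition commutative :: "('a, 'm) monoid_scheme \<Rightarrow> bool" where
  "commutative S \<longleftrightarrow> (\<forall>x\<in>carrier S. \<forall>y\<in>carrier S. x \<otimes>\<^bsub>S\<^esub> y = y \<otimes>\<^bsub>S\<^esub> x)"

definition power_semigroup :: "('a, 'm) monoid_scheme \<Rightarrow> 'a set monoid" where
  "power_semigroup S =
     \<lparr>carrier = {X. X \<subseteq> carrier S \<and> X \<noteq> {}}, mult = (\<lambda>X Y. X <#>\<^bsub>S\<^esub> Y), one = undefined\<rparr>"

definition subsemigroup :: "'a set \<Rightarrow> ('a, 'm) monoid_scheme \<Rightarrow> bool" where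
  "subsemigroup T S \<longleftrightarrow> T \<subseteq> carrier S \<and> (\<forall>x\<in>T. \<forall>y\<in>T. x \<otimes>\<^bsub>S\<^esub> y \<in> T)"

definition downward_complete :: "('a, 'm) monoid_scheme \<Rightarrow> 'a set set \<Rightarrow> bool" where
  "downward_complete S P \<longleftrightarrow>
     subsemigroup P (power_semigroup S) \<and>
     (\<forall>x\<in>carrier S. \<exists>X\<in>P. x \<in> X) \<and>
     (\<forall>X\<in>P. \<forall>Y. Y \<subseteq> X \<and> Y \<noteq> {} \<longrightarrow> Y \<in> P)"

lemma power_semigroup_simps [simp]:
  "carrier (power_semigroup S) = {X. X \<subseteq> carrier S \<and> X \<noteq> {}}"
  "mult (power_semigroup S) X Y = X <#>\<^bsub>S\<^esub> Y"
  by (simp_all add: power_semigroup_def)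

lemma (in mult_semigroup) mult_semigroup_power: "mult_semigroup (power_semigroup S)"
proof
  fix X Y assume "X \<in> carrier (power_semigroup S)" "Y \<in> carrier (power_semigroup S)"
  then show "X \<otimes>\<^bsub>power_semigroup S\<^esub> Y \<in> carrier (power_semigroup S)"
    by (auto simp: set_mult_def m_closed subset_iff)
next
  fix X Y Z
  assume "X \<in> carrier (power_semigroup S)" "Y \<in> carrier (power_semigroup S)"
    "Z \<in> carrier (power_semigroup S)"
  then have "X \<subseteq> carrier S" "Y \<subseteq> carrier S" "Z \<subseteq> carrier S" by auto
  then have "X <#> Y <#> Z = X <#> (Y <#> Z)"
    unfolding set_mult_def by (force simp: m_assoc subset_iff)
  then show "X \<otimes>\<^bsub>power_semigroup S\<^esub> Y \<otimes>\<^bsub>power_semigroup S\<^esub> Z =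
      X \<otimes>\<^bsub>power_semigroup S\<^esub> (Y \<otimes>\<^bsub>power_semigroup S\<^esub> Z)"
    by simp
qed

lemma downward_complete_singleton:
  assumes "downward_complete S P" "x \<in> carrier S"
  shows "{x} \<in> P"
proof -
  obtain X where "X \<in> P" "x \<in> X"
    using assms unfolding downward_complete_def by blast
  then have "{x} \<subseteq> X" "{x} \<noteq> {}" by auto
  with \<open>X \<in> P\<close> show ?thesis
    using assms(1) unfolding downward_complete_def by blast
qed

end

theory Submission
  imports Defs
begin

text \<open>
  The isomorphism \<open>f\<close> preserves every property expressed by multiplication alone, so it suffices to
  single out the one-element sets among the members of a downward complete semigroup of sets by such
  a property. The property is cancellability: \<open>X\<close> is \<^emph>\<open>cancellable\<close> if \<open>XY = XZ\<close> implies \<open>Y = Z\<close>.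

  A one-element set is cancellable because the underlying semigroup is cancellative. Conversely,
  let \<open>X\<close> contain two distinct elements \<open>a\<close> and \<open>b\<close>, and let the semigroup be commutative. Then
  \<open>ab\<close> is dispensable in \<open>X\<^sup>2\<close>, that is, \<open>X(X\<^sup>2 - {ab}) = X X\<^sup>2\<close>
  (lemma \<open>set_mult_drop_product\<close>), since every product \<open>x(ab)\<close> with \<open>x \<in> X\<close> can be
  regrouped: as \<open>a(xb)\<close> if \<open>x \<noteq> a\<close>, and as \<open>b(aa)\<close> if \<open>x = a\<close>. By cancellativity neither \<open>xb\<close> nor
  \<open>aa\<close> is \<open>ab\<close> in these cases. Downward completeness puts \<open>X\<^sup>2 - {ab}\<close>, which contains \<open>aa\<close>, into
  the semigroup of sets, so \<open>X\<close> is not cancellable there.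

  Commutativity of either semigroup gives it for both, because a semigroup is commutative exactly if
  a downward complete semigroup of its subsets is, and the latter property is carried over by \<open>f\<close>.
  Hence \<open>f\<close> maps the one-element subsets of \<open>H\<close> bijectively onto those of \<open>K\<close>.
\<close>

definition cancellable :: "'a set \<Rightarrow> ('a, 'm) monoid_scheme \<Rightarrow> 'a \<Rightarrow> bool" where
  "cancellable P S x \<longleftrightarrow> (\<forall>y\<in>P. \<forall>z\<in>P. x \<otimes>\<^bsub>S\<^esub> y = x \<otimes>\<^bsub>S\<^esub> z \<longrightarrow> y = z)"

lemma iso_cancellable_iff:
  assumes f: "f \<in> iso (S\<lparr>carrier := P\<rparr>) (T\<lparr>carrier := Q\<rparr>)"
    and closed: "\<And>x y. x \<in> P \<Longrightarrow> y \<in> P \<Longrightarrow> x \<otimes>\<^bsub>S\<^esub> y \<in> P"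
    and x: "x \<in> P"
  shows "cancellable Q T (f x) \<longleftrightarrow> cancellable P S x"
proof -
  have bij: "inj_on f P" "f ` P = Q"
    using f by (auto simp: iso_def bij_betw_def)
  have mult: "f (y \<otimes>\<^bsub>S\<^esub> z) = f y \<otimes>\<^bsub>T\<^esub> f z" if "y \<in> P" "z \<in> P" for y z
    using f that by (auto simp: iso_def hom_def)
  have "f x \<otimes>\<^bsub>T\<^esub> f y = f x \<otimes>\<^bsub>T\<^esub> f z \<longleftrightarrow> x \<otimes>\<^bsub>S\<^esub> y = x \<otimes>\<^bsub>S\<^esub> z"
    if "y \<in> P" "z \<in> P" for y z
    using that x by (simp add: mult [symmetric] inj_on_eq_iff [OF bij(1)] closed)
  then have "cancellable Q T (f x) \<longleftrightarrow>
      (\<forall>y\<in>P. \<forall>z\<in>P. x \<otimes>\<^bsub>S\<^esub> y = x \<otimes>\<^bsub>S\<^esub> z \<longrightarrow> f y = f z)"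
    unfolding cancellable_def bij(2) [symmetric] by simp
  then show ?thesis
    using inj_on_eq_iff [OF bij(1)] by (simp add: cancellable_def)
qed

lemma iso_commutative_iff:
  assumes f: "f \<in> iso (S\<lparr>carrier := P\<rparr>) (T\<lparr>carrier := Q\<rparr>)"
    and closed: "\<And>x y. x \<in> P \<Longrightarrow> y \<in> P \<Longrightarrow> x \<otimes>\<^bsub>S\<^esub> y \<in> P"
  shows "commutative (T\<lparr>carrier := Q\<rparr>) \<longleftrightarrow> commutative (S\<lparr>carrier := P\<rparr>)"
proof -
  have bij: "inj_on f P" "f ` P = Q"
    using f by (auto simp: iso_def bij_betw_def)
  have mult: "f (y \<otimes>\<^bsub>S\<^esub> z) = f y \<otimes>\<^bsub>T\<^esub> f z" if "y \<in> P" "z \<in> P" for y z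
    using f that by (auto simp: iso_def hom_def)
  have "f x \<otimes>\<^bsub>T\<^esub> f y = f y \<otimes>\<^bsub>T\<^esub> f x \<longleftrightarrow> x \<otimes>\<^bsub>S\<^esub> y = y \<otimes>\<^bsub>S\<^esub> x"
    if "x \<in> P" "y \<in> P" for x y
    using that by (simp add: mult [symmetric] inj_on_eq_iff [OF bij(1)] closed)
  then show ?thesis
    unfolding commutative_def by (simp add: bij(2) [symmetric])
qed

lemma downward_complete_closed:
  assumes "downward_complete S P" "X \<in> P" "Y \<in> P"
  shows "X \<otimes>\<^bsub>power_semigroup S\<^esub> Y \<in> P"
  using assms unfolding downward_complete_def subsemigroup_def by blast

lemma downward_complete_subset:
  assumes "downward_complete S P" "X \<in> P"
  shows "X \<subseteq> carrier S" and "X \<noteq> {}"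
  using assms by (auto simp: downward_complete_def subsemigroup_def)

lemma downward_complete_downward:
  assumes "downward_complete S P" "X \<in> P" "Y \<subseteq> X" "Y \<noteq> {}"
  shows "Y \<in> P"
  using assms unfolding downward_complete_def by blast

lemma set_mult_singletons [simp]: "{x} <#>\<^bsub>S\<^esub> {y} = {x \<otimes>\<^bsub>S\<^esub> y}"
  by (simp add: set_mult_def)

lemma commutative_downward_complete_iff:
  assumes P: "downward_complete S P"
  shows "commutative ((power_semigroup S)\<lparr>carrier := P\<rparr>) \<longleftrightarrow> commutative S"
proof
  assume comm: "commutative ((power_semigroup S)\<lparr>carrier := P\<rparr>)"
  have "{x} <#>\<^bsub>S\<^esub> {y} = {y} <#>\<^bsub>S\<^esub> {x}" if "x \<in> carrier S" "y \<in> carrier S" for x y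
  proof -
    have "{x} \<in> P" "{y} \<in> P"
      using that downward_complete_singleton [OF P] by auto
    then show ?thesis
      using bspec [OF bspec [OF comm [unfolded commutative_def]], of "{x}" "{y}"]
      by (simp del: set_mult_singletons)
  qed
  then show "commutative S"
    by (simp add: commutative_def)
next
  assume comm: "commutative S"
  have "X <#>\<^bsub>S\<^esub> Y = Y <#>\<^bsub>S\<^esub> X" if "X \<in> P" "Y \<in> P" for X Y
  proof -
    have "x \<otimes>\<^bsub>S\<^esub> y = y \<otimes>\<^bsub>S\<^esub> x" if "x \<in> X" "y \<in> Y" for x y
      using comm that downward_complete_subset(1) [OF P] \<open>X \<in> P\<close> \<open>Y \<in> P\<close>
      unfolding commutative_def by blast
    then show ?thesis
      unfolding set_mult_def by fastforce
  qed
  then show "commutative ((power_semigroup S)\<lparr>carrier := P\<rparr>)"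
    by (simp add: commutative_def)
qed

text \<open>
  The deleted product \<open>ab\<close> is recovered by regrouping: its multiple \<open>x(ab)\<close> has another factorization
  into an element of \<open>X\<close> and an element of \<open>X\<^sup>2\<close> different from \<open>ab\<close>.
\<close>

lemma (in cancellative_semigroup) set_mult_drop_product:
  assumes comm: "commutative S" and X: "X \<subseteq> carrier S"
    and ab: "a \<in> X" "b \<in> X" "a \<noteq> b"
  shows "X <#> ((X <#> X) - {a \<otimes> b}) = X <#> (X <#> X)"
proof
  show "X <#> ((X <#> X) - {a \<otimes> b}) \<subseteq> X <#> (X <#> X)"
    by (auto simp: set_mult_def)
next
  have swap: "x \<otimes> y = y \<otimes> x" if "x \<in> X" "y \<in> X" for x y
    using comm X that by (auto simp: commutative_def)
  have assoc: "x \<otimes> y \<otimes> z = x \<otimes> (y \<otimes> z)" if "x \<in> X" "y \<in> X" "z \<in> X" for x y z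
    using X that by (auto intro: m_assoc)
  have prod: "x \<otimes> y \<in> X <#> X" if "x \<in> X" "y \<in> X" for x y
    using that by (auto simp: set_mult_def)
  have mem: "x \<otimes> w \<in> X <#> ((X <#> X) - {a \<otimes> b})"
    if "x \<in> X" "w \<in> X <#> X" "w \<noteq> a \<otimes> b" for x w
    using that unfolding set_mult_def [of S X "(X <#> X) - {a \<otimes> b}"] by blast
  have recover: "x \<otimes> (a \<otimes> b) \<in> X <#> ((X <#> X) - {a \<otimes> b})" if x: "x \<in> X" for x
  proof (cases "x = a")
    case True
    have "x \<otimes> (a \<otimes> b) = b \<otimes> (a \<otimes> a)"
      using True ab assoc [of a a b] swap [of a b] assoc [of a b a] assoc [of b a a] by simp
    moreover have "a \<otimes> a \<noteq> a \<otimes> b"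
      using inj_onD [OF inj_left] ab X by blast
    ultimately show ?thesis
      using mem [OF ab(2) prod] ab by simp
  next
    case False
    have "x \<otimes> (a \<otimes> b) = a \<otimes> (x \<otimes> b)"
      using x ab assoc [of x a b] swap [of x a] assoc [of a x b] by simp
    moreover have "x \<otimes> b \<noteq> a \<otimes> b"
      using inj_onD [OF inj_right] False x ab X by blast
    ultimately show ?thesis
      using mem [OF ab(1) prod] x ab by simp
  qed
  show "X <#> (X <#> X) \<subseteq> X <#> ((X <#> X) - {a \<otimes> b})"
  proof
    fix u assume "u \<in> X <#> (X <#> X)"
    then obtain x w where "x \<in> X" "w \<in> X <#> X" "u = x \<otimes> w"
      unfolding set_mult_def by blast
    then show "u \<in> X <#> ((X <#> X) - {a \<otimes> b})"
      using mem recover by blast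
  qed
qed

lemma (in cancellative_semigroup) cancellable_iff_singleton:
  assumes comm: "commutative S" and P: "downward_complete S P" and X: "X \<in> P"
  shows "cancellable P (power_semigroup S) X \<longleftrightarrow> (\<exists>x\<in>carrier S. X = {x})"
proof
  assume canc: "cancellable P (power_semigroup S) X"
  note XS = downward_complete_subset [OF P X]
  have "a = b" if ab: "a \<in> X" "b \<in> X" for a b
  proof (rule ccontr)
    assume "a \<noteq> b"
    let ?Y = "(X <#> X) - {a \<otimes> b}"
    have XX: "X <#> X \<in> P"
      using downward_complete_closed [OF P X X] by simp
    have "a \<otimes> a \<noteq> a \<otimes> b"
      using inj_onD [OF inj_left] ab XS \<open>a \<noteq> b\<close> by blast
    then have "a \<otimes> a \<in> ?Y"
      using ab by (auto simp: set_mult_def)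
    then have "?Y \<in> P"
      by (intro downward_complete_downward [OF P XX]) auto
    then have "?Y = X <#> X"
      using canc XX set_mult_drop_product [OF comm XS(1) ab \<open>a \<noteq> b\<close>]
      by (simp add: cancellable_def)
    moreover have "a \<otimes> b \<in> X <#> X"
      using ab by (auto simp: set_mult_def)
    ultimately show False by blast
  qed
  then show "\<exists>x\<in>carrier S. X = {x}"
    using XS by blast
next
  assume "\<exists>x\<in>carrier S. X = {x}"
  then obtain x where x: "x \<in> carrier S" "X = {x}" by blast
  have translate: "X <#> Y = (\<lambda>y. x \<otimes> y) ` Y" for Y
    by (auto simp: set_mult_def x(2))
  show "cancellable P (power_semigroup S) X"
    unfolding cancellable_def
    using inj_on_image_eq_iff [OF inj_left [OF x(1)]] downward_complete_subset(1) [OF P]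
    by (simp add: translate)
qed

theorem theorem1:
  fixes H :: "('a, 'm) monoid_scheme" and K :: "('b, 'n) monoid_scheme"
    and P :: "'a set set" and Q :: "'b set set" and f :: "'a set \<Rightarrow> 'b set"
  assumes "cancellative_semigroup H" and "cancellative_semigroup K"
    and "commutative H \<or> commutative K"
    and "downward_complete H P" and "downward_complete K Q"
    and "f \<in> iso ((power_semigroup H)\<lparr>carrier := P\<rparr>) ((power_semigroup K)\<lparr>carrier := Q\<rparr>)"
  shows "\<exists>\<phi>\<in>iso H K. \<forall>x\<in>carrier H. f {x} = {\<phi> x}"
proof -
  interpret H: cancellative_semigroup H by fact
  interpret K: cancellative_semigroup K by fact
  note P = assms(4) and Q = assms(5) and f = assms(6)
  note closed = downward_complete_closed [OF P]
  note single = downward_complete_singleton [OF P]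
  have "commutative H \<longleftrightarrow> commutative K"
    using iso_commutative_iff [OF f closed]
    by (simp add: commutative_downward_complete_iff [OF P] commutative_downward_complete_iff [OF Q])
  with assms(3) have comm: "commutative H" "commutative K" by auto
  have bij: "inj_on f P" "f ` P = Q"
    using f by (auto simp: iso_def bij_betw_def)
  have mult: "f (X <#>\<^bsub>H\<^esub> Y) = f X <#>\<^bsub>K\<^esub> f Y" if "X \<in> P" "Y \<in> P" for X Y
    using f that by (auto simp: iso_def hom_def)
  have singleton_iff: "(\<exists>y\<in>carrier K. f X = {y}) \<longleftrightarrow> (\<exists>x\<in>carrier H. X = {x})"
    if "X \<in> P" for X
  proof -
    have "f X \<in> Q"
      using bij(2) that by blast
    then show ?thesis
      using iso_cancellable_iff [OF f closed that] H.cancellable_iff_singleton [OF comm(1) P that]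
        K.cancellable_iff_singleton [OF comm(2) Q] by simp
  qed
  have "\<forall>x\<in>carrier H. \<exists>y\<in>carrier K. f {x} = {y}"
    using singleton_iff single by blast
  then obtain \<phi> where \<phi>: "\<And>x. x \<in> carrier H \<Longrightarrow> \<phi> x \<in> carrier K"
      "\<And>x. x \<in> carrier H \<Longrightarrow> f {x} = {\<phi> x}"
    by metis
  have "\<phi> (x \<otimes>\<^bsub>H\<^esub> y) = \<phi> x \<otimes>\<^bsub>K\<^esub> \<phi> y" if "x \<in> carrier H" "y \<in> carrier H" for x y
    using mult [OF single single, OF that] that by (simp add: \<phi>(2) H.m_closed)
  then have "\<phi> \<in> hom H K"
    using \<phi>(1) by (auto simp: hom_def)
  moreover have "inj_on \<phi> (carrier H)"
  proof
    fix x y assume xy: "x \<in> carrier H" "y \<in> carrier H" "\<phi> x = \<phi> y"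
    then have "f {x} = f {y}"
      by (simp add: \<phi>(2))
    then show "x = y"
      using inj_onD [OF bij(1)] single xy by blast
  qed
  moreover have "\<phi> ` carrier H = carrier K"
  proof
    show "\<phi> ` carrier H \<subseteq> carrier K"
      using \<phi>(1) by blast
    show "carrier K \<subseteq> \<phi> ` carrier H"
    proof
      fix y assume y: "y \<in> carrier K"
      then obtain X where X: "X \<in> P" "f X = {y}"
        using downward_complete_singleton [OF Q y] bij(2) by force
      then obtain x where "x \<in> carrier H" "X = {x}"
        using singleton_iff [OF X(1)] y by blast
      then show "y \<in> \<phi> ` carrier H"
        using X(2) \<phi>(2) by auto
    qed
  qed
  ultimately have "\<phi> \<in> iso H K"
    by (simp add: iso_def bij_betw_def)
  then show ?thesis
    using \<phi>(2) by blast
qed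

end
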